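(* Let $X,Y,Z_p$ be variables satisfying $XY-qYX=hf(Y)Z_p$, $Z_pY=pYZ_p$, $XZ_p=pZ_pX$, $Z_1=I$, where $f(y)=\sum_{j=0}^s\alpha_jy^j$ is a polynomial. Then for every $m\in\mathbb{N}_0$ the normal ordered form of $X^mY$ is given by $$X^mY=\sum_{j=0}^mh^j\Big(\sum_{\lambda\in\mathcal{I}_{m-j,j}}q^{m-j-|\lambda|}p^{|\lambda|}g_j(\lambda;Y)\Big)Z_p^jX^{m-j}.$$
   Context: $p,q$ are two commuting indeterminates and $h$ is a scalar; $p,q,h$ are central scalars in the unital associative algebra containing $X,Y,Z_p$. The convention $Z_1=I$ means that $Z_p$ is the identity when $p=1$. Normal ordered form: a linear combination of monomials $Y^aZ_p^bX^c$. $[n]_{p,q}=\frac{p^n-q^n}{p-q}$. $\mathcal{I}_{\ell,k}$ is the set of Young diagrams contained in an $\ell\times k$ box ($\ell$ rows, $k$ columns), the diagram of $\lambda$ having $\lambda_i$ boxes in column $i$; that is, $\mathcal{I}_{\ell,k}$ is identified with the set of sequences $\lambda=(\lambda_1,\dots,\lambda_k)$ of integers with $\ell\ge\lambda_1\ge\cdots\ge\lambda_k\ge0$ (for $k=0$ only the empty partition). $|\lambda|=\sum_i\lambda_i$. For $\lambda=(\lambda_1,\dots,\lambda_d)$ with $d\ge1$ parts, $$g_d(\lambda;Y)=\sum_{i_1,\dots,i_d=0}^s\Big(q^{\sum_{j=1}^di_j\lambda_j}\prod_{j=1}^d\alpha_{i_j}\prod_{j=1}^{d-1}[i_1+\cdots+i_j+1-j]_{p,q}\Big)Y^{i_1+\cdots+i_d+1-d},$$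 and $g_0(\emptyset;Y)=Y$. Summands containing a factor $[0]_{p,q}=0$ are read as zero (in particular negative powers of $Y$ do not occur). *)

theory Defs
  imports Complex_Main
begin

text \<open>
  Unital associative algebras, not necessarily commutative, over a field of central scalars.
\<close>

locale unital_algebra = vector_space scale
  for scale :: "'k::field \<Rightarrow> 'a::ring_1 \<Rightarrow> 'a" +
  assumes scale_mult_left: "scale c x * y = scale c (x * y)"
    and scale_mult_right: "x * scale c y = scale c (x * y)"

definition poly_at :: "('k::field \<Rightarrow> 'a::ring_1 \<Rightarrow> 'a) \<Rightarrow> nat \<Rightarrow> (nat \<Rightarrow> 'k) \<Rightarrow> 'a \<Rightarrow> 'a" where
  "poly_at scale s \<alpha> Y = (\<Sum>j=0..s. scale (\<alpha> j) (Y ^ j))"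

text \<open>
  The deformed integer is defined for integer arguments because
  \<open>i\<^sub>1 + \<dots> + i\<^sub>j + 1 - j\<close> may be negative. It is only meaningful for \<open>p \<noteq> q\<close>.
\<close>

definition pq_number :: "'k::field \<Rightarrow> 'k \<Rightarrow> int \<Rightarrow> 'k" where
  "pq_number p q n = (p powi n - q powi n) / (p - q)"

text \<open>
  Young diagrams in a box with \<open>l\<close> rows and \<open>k\<close> columns, given by the weakly decreasing list of
  their \<open>k\<close> column lengths (zeros are kept).
\<close>

definition box_partitions :: "nat \<Rightarrow> nat \<Rightarrow> nat list set" where
  "box_partitions l k = {\<mu>. length \<mu> = k \<and> sorted_wrt (\<ge>) \<mu> \<and> set \<mu> \<subseteq> {0..l}}"

text \<open>
  A tuple \<open>(i\<^sub>1, \<dots>, i\<^sub>d)\<close> is a list \<open>ix\<close>, so \<open>i\<^sub>j\<close> is \<open>ix ! (j - 1)\<close> and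
  \<open>i\<^sub>1 + \<dots> + i\<^sub>j\<close> is \<open>sum_list (take j ix)\<close>. A summand with a factor \<open>pq_number p q 0 = 0\<close> vanishes.
  If the exponent \<open>i\<^sub>1 + \<dots> + i\<^sub>d + 1 - d\<close> of \<open>Y\<close> is negative, such a factor occurs: the numbers
  \<open>i\<^sub>1 + \<dots> + i\<^sub>j + 1 - j\<close> start at \<open>1\<close> for \<open>j = 0\<close> and decrease by at most \<open>1\<close> in each step. So the
  truncation by \<open>nat\<close> affects no nonzero summand.
\<close>

definition g_poly ::
  "('k::field \<Rightarrow> 'a::ring_1 \<Rightarrow> 'a) \<Rightarrow> 'k \<Rightarrow> 'k \<Rightarrow> nat \<Rightarrow> (nat \<Rightarrow> 'k) \<Rightarrow> nat \<Rightarrow> nat list \<Rightarrow> 'a \<Rightarrow> 'a" where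
  "g_poly scale p q s \<alpha> d \<mu> Y =
     (if d = 0 then Y
      else (\<Sum>ix \<in> {ix. length ix = d \<and> set ix \<subseteq> {0..s}}.
        scale
          (q ^ (\<Sum>j<d. ix ! j * \<mu> ! j)
            * (\<Prod>j<d. \<alpha> (ix ! j))
            * (\<Prod>j=1..d-1. pq_number p q (int (sum_list (take j ix)) + 1 - int j)))
          (Y ^ nat (int (sum_list ix) + 1 - int d))))"

definition normal_ordered ::
  "('k::field \<Rightarrow> 'a::ring_1 \<Rightarrow> 'a) \<Rightarrow> 'a \<Rightarrow> 'a \<Rightarrow> 'a \<Rightarrow> 'a set" where
  "normal_ordered scale Y Z X = module.span scale {Y ^ a * Z ^ b * X ^ c | a b c. True}"

end

theory Submission
  imports Defs
begin

text \<open>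
  Moving one \<open>X\<close> to the right past \<open>Y ^ n\<close> gives
  \<open>X Y\<^sup>n = q\<^sup>n Y\<^sup>n X + h [n] Y\<^sup>n\<^sup>-\<^sup>1 f(Y) Z\<close>. Hence \<open>X g\<^sub>d(\<mu>; Y)\<close> is, up to
  a power of \<open>q\<close>, \<open>g\<^sub>d(\<mu> + 1; Y) X\<close> (every column grows by a box) plus \<open>h g\<^sub>d\<^sub>+\<^sub>1((\<mu>, 0); Y) Z\<close>
  (an empty column is appended). Every nonempty list of column lengths arises in exactly one of
  these two ways, according to whether its last column is empty, so the formula follows by
  induction on \<open>m\<close>.
\<close>

section \<open>Young diagrams in a box, sorted by whether the last column is empty\<close>

lemma box_partitions_0: "box_partitions l 0 = {[]}"
  by (auto simp: box_partitions_def)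

lemma finite_box_partitions: "finite (box_partitions l k)"
  by (rule finite_subset[OF _ finite_lists_length_eq[of "{0..l}" k]])
    (auto simp: box_partitions_def)

lemma box_partitions_last_empty:
  "{\<nu> \<in> box_partitions l (Suc k). last \<nu> = 0} = (\<lambda>\<mu>. \<mu> @ [0]) ` box_partitions l k"
proof -
  have "\<nu> \<in> (\<lambda>\<mu>. \<mu> @ [0]) ` box_partitions l k"
    if "\<nu> \<in> box_partitions l (Suc k)" "last \<nu> = 0" for \<nu>
    using that by (cases \<nu> rule: rev_cases) (auto simp: box_partitions_def sorted_wrt_append)
  then show ?thesis
    by (auto simp: box_partitions_def sorted_wrt_append)
qed

text \<open>The last column is the shortest, so if it is nonempty then every column is, and one full
  row can be removed. This lowers the box by one row.\<close>

lemma box_partitions_last_nonempty: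
  "{\<nu> \<in> box_partitions (Suc l) (Suc k). last \<nu> \<noteq> 0} = map Suc ` box_partitions l (Suc k)"
proof -
  have "\<nu> \<in> map Suc ` box_partitions l (Suc k)"
    if *: "\<nu> \<in> box_partitions (Suc l) (Suc k)" "last \<nu> \<noteq> 0" for \<nu>
  proof
    have pos: "x > 0" if "x \<in> set \<nu>" for x
      using that * by (cases \<nu> rule: rev_cases) (auto simp: box_partitions_def sorted_wrt_append)
    show "\<nu> = map Suc (map (\<lambda>x. x - 1) \<nu>)"
      using pos by (simp add: map_idI)
    show "map (\<lambda>x. x - 1) \<nu> \<in> box_partitions l (Suc k)"
      using * by (force simp: box_partitions_def sorted_wrt_map intro: sorted_wrt_mono_rel[of _ "(\<ge>)"])
  qed
  moreover have "last (map Suc \<mu>) \<noteq> 0" if "\<mu> \<in> box_partitions l (Suc k)" for \<mu>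
    using that by (cases \<mu> rule: rev_cases) (auto simp: box_partitions_def)
  moreover have "map Suc \<mu> \<in> box_partitions (Suc l) (Suc k)"
    if "\<mu> \<in> box_partitions l (Suc k)" for \<mu>
    using that by (auto simp: box_partitions_def sorted_wrt_map)
  ultimately show ?thesis
    by blast
qed

lemma box_partitions_last_nonempty_0:
  "{\<nu> \<in> box_partitions 0 (Suc k). last \<nu> \<noteq> 0} = {}"
proof -
  have "last \<nu> = 0" if "\<nu> \<in> box_partitions 0 (Suc k)" for \<nu>
    using that by (cases \<nu> rule: rev_cases) (auto simp: box_partitions_def)
  then show ?thesis
    by auto
qed

text \<open>The nonempty part stays a filtered set because its description by \<open>map Suc\<close>
  is available only when the box has a row; the case \<open>l = 0\<close> is treated apart.\<close>

lemma sum_box_partitions_split: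
  fixes F :: "nat list \<Rightarrow> 'a::comm_monoid_add"
  shows "sum F (box_partitions l (Suc k)) =
      sum F {\<nu> \<in> box_partitions l (Suc k). last \<nu> \<noteq> 0}
        + (\<Sum>\<mu>\<in>box_partitions l k. F (\<mu> @ [0]))"
proof -
  let ?B = "box_partitions l (Suc k)"
  have "sum F ?B = sum F ({\<nu> \<in> ?B. last \<nu> \<noteq> 0} \<union> {\<nu> \<in> ?B. last \<nu> = 0})"
    by (rule sum.cong) auto
  also have "\<dots> = sum F {\<nu> \<in> ?B. last \<nu> \<noteq> 0} + sum F {\<nu> \<in> ?B. last \<nu> = 0}"
    by (rule sum.union_disjoint) (auto simp: finite_box_partitions)
  also have "sum F {\<nu> \<in> ?B. last \<nu> = 0} = (\<Sum>\<mu>\<in>box_partitions l k. F (\<mu> @ [0]))"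
    unfolding box_partitions_last_empty by (subst sum.reindex) (auto simp: inj_on_def)
  finally show ?thesis .
qed

lemma sum_box_partitions_nonempty:
  fixes F :: "nat list \<Rightarrow> 'a::comm_monoid_add"
  shows "sum F {\<nu> \<in> box_partitions (Suc l) (Suc k). last \<nu> \<noteq> 0} =
      (\<Sum>\<mu>\<in>box_partitions l (Suc k). F (map Suc \<mu>))"
  unfolding box_partitions_last_nonempty by (subst sum.reindex) (auto simp: inj_on_def inj_map_eq_map)

section \<open>Index tuples, pq-numbers and the coefficients of \<open>g_poly\<close>\<close>

lemma sum_list_map_Suc: "sum_list (map Suc xs) = sum_list xs + length xs"
  by (induction xs) auto

lemma sum_lists_snoc:
  fixes F :: "'b list \<Rightarrow> 'a::comm_monoid_add"
  shows "(\<Sum>ix\<in>{ix. length ix = Suc d \<and> set ix \<subseteq> A}. F ix) =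
      (\<Sum>ix\<in>{ix. length ix = d \<and> set ix \<subseteq> A}. \<Sum>i\<in>A. F (ix @ [i]))"
proof -
  have "{ix. length ix = Suc d \<and> set ix \<subseteq> A} =
      (\<lambda>(ix, i). ix @ [i]) ` ({ix. length ix = d \<and> set ix \<subseteq> A} \<times> A)" (is "?L = ?R")
  proof
    show "?L \<subseteq> ?R"
    proof
      fix ix assume "ix \<in> ?L"
      then show "ix \<in> ?R"
        by (cases ix rule: rev_cases) (auto simp: image_iff)
    qed
  qed auto
  then show ?thesis
    by (simp add: sum.cartesian_product sum.reindex inj_on_def case_prod_unfold)
qed

lemma pq_number_0 [simp]: "pq_number p q 0 = 0"
  by (simp add: pq_number_def)

lemma pq_number_1: "p \<noteq> q \<Longrightarrow> pq_number p q 1 = 1"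
  by (simp add: pq_number_def)

lemma pq_number_Suc:
  assumes "p \<noteq> q"
  shows "pq_number p q (int (Suc n)) = p * pq_number p q (int n) + q ^ n"
  using assms unfolding pq_number_def power_int_of_nat by (simp add: field_simps)

text \<open>A discrete intermediate value argument: \<open>sum_list (take j ix) + 1 - j\<close>
  starts at 1 and falls by at most 1 per step, so it cannot become negative without passing through
  0.\<close>

lemma partial_sum_hits_zero:
  fixes ix :: "nat list"
  assumes "sum_list (take d ix) + 1 < d"
  shows "\<exists>j<d. sum_list (take j ix) + 1 = j"
  using assms
proof (induction d)
  case (Suc d)
  have "sum_list (take d ix) \<le> sum_list (take (Suc d) ix)"
    by (cases "d < length ix") (auto simp: take_Suc_conv_app_nth)
  with Suc.prems have "sum_list (take d ix) + 1 = d \<or> sum_list (take d ix) + 1 < d"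
    by linarith
  with Suc.IH show ?case
    by (metis less_Suc_eq)
qed simp

text \<open>
  The product includes the factor \<open>[1] = 1\<close> at \<open>j = 0\<close>, so that it extends by one factor with
  each appended index, also from \<open>d = 0\<close> to \<open>d = 1\<close>.
\<close>

definition g_coeff :: "'k::field \<Rightarrow> 'k \<Rightarrow> (nat \<Rightarrow> 'k) \<Rightarrow> nat \<Rightarrow> nat list \<Rightarrow> nat list \<Rightarrow> 'k" where
  "g_coeff p q \<alpha> d \<mu> ix =
     q ^ (\<Sum>j<d. ix ! j * \<mu> ! j)
       * (\<Prod>j<d. \<alpha> (ix ! j) * pq_number p q (int (sum_list (take j ix)) + 1 - int j))"

text \<open>This makes the truncation of exponents by \<open>nat\<close> harmless: wherever the true
  exponent is negative, some factor is \<open>pq_number p q 0\<close>.\<close>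

lemma g_coeff_eq_0:
  assumes "length ix = d" "sum_list ix + 1 < d"
  shows "g_coeff p q \<alpha> d \<mu> ix = 0"
proof -
  obtain j where "j < d" "sum_list (take j ix) + 1 = j"
    using partial_sum_hits_zero[of d ix] assms by auto
  moreover from this have "int (sum_list (take j ix)) + 1 - int j = 0"
    by linarith
  ultimately have "\<exists>j<d. pq_number p q (int (sum_list (take j ix)) + 1 - int j) = 0"
    by (metis pq_number_0)
  then show ?thesis
    by (auto simp: g_coeff_def)
qed

text \<open>The empty column gives the new index no power of \<open>q\<close>. The new pq-number is
  the one that \<open>X_Y_power\<close> produces for the exponent of \<open>Y\<close> belonging to
  \<open>ix\<close>.\<close>

lemma g_coeff_snoc:
  assumes "length ix = d" "length \<mu> = d"
  shows "g_coeff p q \<alpha> (Suc d) (\<mu> @ [0]) (ix @ [i]) =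
      g_coeff p q \<alpha> d \<mu> ix * \<alpha> i * pq_number p q (int (sum_list ix) + 1 - int d)"
  using assms by (simp add: g_coeff_def nth_append mult.assoc)

lemma g_coeff_map_Suc:
  assumes "length ix = d" "length \<mu> = d"
  shows "g_coeff p q \<alpha> d (map Suc \<mu>) ix = q ^ sum_list ix * g_coeff p q \<alpha> d \<mu> ix"
proof -
  have "(\<Sum>j<d. ix ! j * map Suc \<mu> ! j) = sum_list ix + (\<Sum>j<d. ix ! j * \<mu> ! j)"
    using assms by (simp add: sum.distrib sum_list_sum_nth atLeast0LessThan)
  then show ?thesis
    by (simp add: g_coeff_def power_add mult.assoc)
qed

text \<open>For \<open>d = 0\<close> the only tuple is \<open>[]\<close>, with coefficient 1 and
  exponent 1, so the value \<open>Y\<close> set by convention fits the general sum.\<close>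

lemma g_poly_eq_sum_g_coeff:
  assumes "p \<noteq> q" and "vector_space scale"
  shows "g_poly scale p q s \<alpha> d \<mu> Y =
    (\<Sum>ix \<in> {ix. length ix = d \<and> set ix \<subseteq> {0..s}}.
        scale (g_coeff p q \<alpha> d \<mu> ix) (Y ^ nat (int (sum_list ix) + 1 - int d)))"
proof (cases "d = 0")
  case True
  interpret vector_space scale by fact
  have "{ix. ix = [] \<and> set ix \<subseteq> {0..s}} = {[]}"
    by auto
  with True show ?thesis
    by (simp add: g_poly_def g_coeff_def)
next
  case False
  have "(\<Prod>j<d. \<alpha> (ix ! j)) * (\<Prod>j=1..d-1. pq_number p q (int (sum_list (take j ix)) + 1 - int j))
      = (\<Prod>j<d. \<alpha> (ix ! j) * pq_number p q (int (sum_list (take j ix)) + 1 - int j))" for ix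
  proof -
    have "{..<d} = insert 0 {1..d-1}"
      using False by auto
    then have "(\<Prod>j=1..d-1. pq_number p q (int (sum_list (take j ix)) + 1 - int j)) =
        (\<Prod>j<d. pq_number p q (int (sum_list (take j ix)) + 1 - int j))"
      by (simp add: pq_number_1[OF assms(1)])
    then show ?thesis
      by (simp add: prod.distrib)
  qed
  with False show ?thesis
    by (simp only: g_poly_def g_coeff_def mult.assoc if_False)
qed

section \<open>Commuting \<open>X\<close> past powers of \<open>Z\<close> and \<open>Y\<close>, and
  past \<open>g\<close>\<close>

locale pq_algebra = unital_algebra scale
  for scale :: "'k::field \<Rightarrow> 'a::ring_1 \<Rightarrow> 'a" (infixr "*s" 75) +
  fixes p q h :: 'k and s :: nat and \<alpha> :: "nat \<Rightarrow> 'k" and X Y Z :: 'a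
  assumes q_nonzero: "q \<noteq> 0" and p_neq_q: "p \<noteq> q"
    and X_Y: "X * Y - q *s (Y * X) = h *s (poly_at scale s \<alpha> Y * Z)"
    and Z_Y: "Z * Y = p *s (Y * Z)"
    and X_Z: "X * Z = p *s (Z * X)"
begin

abbreviation f :: 'a where "f \<equiv> poly_at scale s \<alpha> Y"

abbreviation g :: "nat \<Rightarrow> nat list \<Rightarrow> 'a" where "g d \<mu> \<equiv> g_poly scale p q s \<alpha> d \<mu> Y"

abbreviation tuples :: "nat \<Rightarrow> nat list set" where
  "tuples d \<equiv> {ix. length ix = d \<and> set ix \<subseteq> {0..s}}"

lemma X_Z_power: "X * Z ^ n = p ^ n *s (Z ^ n * X)"
proof (induction n)
  case (Suc n)
  have "X * Z ^ Suc n = (X * Z ^ n) * Z"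
    by (simp add: power_Suc2 mult.assoc del: power_Suc)
  also have "\<dots> = p ^ Suc n *s (Z ^ Suc n * X)"
    by (simp add: Suc scale_mult_left scale_mult_right mult.assoc X_Z power_Suc2 mult.commute
        del: power_Suc)
  finally show ?case .
qed simp

lemma poly_commute: "f * Y = Y * f"
  by (simp add: poly_at_def sum_distrib_left sum_distrib_right scale_mult_left scale_mult_right
      power_commutes)

text \<open>Induction by splitting off the last \<open>Y\<close>. Carrying it past \<open>Z\<close>
  costs a factor \<open>p\<close>, and \<open>X * Y\<close> adds a new term with
  \<open>q ^ n\<close>, which matches [n+1] = p [n] + q^n.\<close>

lemma X_Y_power:
  "X * Y ^ n = q ^ n *s (Y ^ n * X) + (h * pq_number p q (int n)) *s (Y ^ (n - 1) * f * Z)"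
proof (induction n)
  case (Suc n)
  have shift: "(h * pq_number p q (int n)) *s (Y ^ (n - 1) * f * Z * Y) =
      (h * pq_number p q (int n) * p) *s (Y ^ n * f * Z)"
  \<comment> \<open>For \<open>n = 0\<close> the exponent \<open>n - 1\<close> is truncated, but
    both coefficients contain [0] = 0.\<close>
  proof (cases n)
    case (Suc k)
    have "Y ^ k * f * Z * Y = Y ^ k * f * (Z * Y)"
      by (simp add: mult.assoc)
    also have "\<dots> = p *s (Y ^ k * (f * Y) * Z)"
      by (simp add: Z_Y scale_mult_right mult.assoc)
    also have "\<dots> = p *s (Y ^ n * f * Z)"
      unfolding poly_commute Suc by (simp add: mult.assoc power_commutes flip: mult.assoc)
    finally show ?thesis
      using Suc by simp
  qed simp
  have XY: "X * Y = q *s (Y * X) + h *s (f * Z)"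
    using X_Y by (simp add: algebra_simps)
  have "X * Y ^ Suc n = (X * Y ^ n) * Y"
    by (simp add: power_Suc2 mult.assoc del: power_Suc)
  also have "\<dots> = q ^ n *s (Y ^ n * (X * Y))
      + (h * pq_number p q (int n)) *s (Y ^ (n - 1) * f * Z * Y)"
    by (simp add: Suc distrib_right scale_mult_left mult.assoc)
  also have "\<dots> = q ^ Suc n *s (Y ^ Suc n * X)
      + (q ^ n * h + h * pq_number p q (int n) * p) *s (Y ^ n * f * Z)"
    unfolding shift XY
    by (simp add: distrib_left scale_mult_right scale_right_distrib scale_left_distrib mult.assoc
        power_Suc2 mult.commute[of q] del: power_Suc)
  also have "q ^ n * h + h * pq_number p q (int n) * p = h * pq_number p q (int (Suc n))"
    by (simp only: pq_number_Suc[OF p_neq_q] algebra_simps)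
  finally show ?case
    by simp
qed simp

text \<open>A term with exponent e = |ix| + 1 - d picks up q^e = q^(1-d) q^|ix|; the factor q^|ix|
  is the effect of one more box in every column. In the remaining term, expanding \<open>f\<close>
  over its monomials supplies the new last index.\<close>

lemma X_g:
  assumes "length \<mu> = d"
  shows "X * g d \<mu> = q powi (1 - int d) *s (g d (map Suc \<mu>) * X) + h *s (g (Suc d) (\<mu> @ [0]) * Z)"
proof -
  let ?c = "g_coeff p q \<alpha> d \<mu>"
  let ?e = "\<lambda>ix. nat (int (sum_list ix) + 1 - int d)"
  note g_sum = g_poly_eq_sum_g_coeff[OF p_neq_q vector_space_axioms]
  have grow: "(?c ix * q ^ ?e ix) *s (Y ^ ?e ix * X) =
      q powi (1 - int d) *s (g_coeff p q \<alpha> d (map Suc \<mu>) ix *s (Y ^ ?e ix * X))"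
    if "ix \<in> tuples d" for ix
  \<comment> \<open>If the true exponent is negative, \<open>q ^ ?e ix\<close> is not the intended
    power, but both sides vanish by \<open>g_coeff_eq_0\<close>.\<close>
  proof (cases "sum_list ix + 1 < d")
    case True
    with that show ?thesis
      by (simp add: g_coeff_eq_0)
  next
    case False
    then have "q ^ ?e ix = q powi (int (sum_list ix) + (1 - int d))"
      by (simp add: power_int_def algebra_simps)
    also have "\<dots> = q powi (1 - int d) * q ^ sum_list ix"
      using q_nonzero by (simp add: power_int_add)
    finally show ?thesis
      using that assms by (simp add: g_coeff_map_Suc mult_ac)
  qed
  have append: "(?c ix * (h * pq_number p q (int (?e ix)))) *s (Y ^ (?e ix - 1) * f * Z) =
      h *s (\<Sum>i=0..s. g_coeff p q \<alpha> (Suc d) (\<mu> @ [0]) (ix @ [i]) *s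
        (Y ^ nat (int (sum_list (ix @ [i])) + 1 - int (Suc d)) * Z))"
    if "ix \<in> tuples d" for ix
  \<comment> \<open>A negative exponent kills \<open>?c ix\<close>, exponent 0 kills the pq-number.
    Otherwise the exponent is at least 1, and subtracting 1 from it is exact.\<close>
  proof (cases "sum_list ix + 1 \<le> d")
    case True
    then have "sum_list ix + 1 < d \<or> int (sum_list ix) + 1 - int d = 0"
      by linarith
    then have "?c ix * pq_number p q (int (sum_list ix) + 1 - int d) = 0"
      using that by (auto simp: g_coeff_eq_0)
    moreover have "?e ix = 0"
      using True by simp
    ultimately show ?thesis
      using that assms by (auto simp: g_coeff_snoc)
  next
    case False
    then have e: "int (?e ix) = int (sum_list ix) + 1 - int d"
      and "nat (int (sum_list (ix @ [i])) + 1 - int (Suc d)) = ?e ix - 1 + i" for i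
      by auto
    then have "(\<Sum>i=0..s. g_coeff p q \<alpha> (Suc d) (\<mu> @ [0]) (ix @ [i]) *s
        (Y ^ nat (int (sum_list (ix @ [i])) + 1 - int (Suc d)) * Z)) =
      (\<Sum>i=0..s. (?c ix * pq_number p q (int (?e ix))) *s (\<alpha> i *s (Y ^ (?e ix - 1) * Y ^ i * Z)))"
      using that assms by (intro sum.cong refl) (simp add: g_coeff_snoc power_add mult_ac del: sum_list_append)
    also have "\<dots> = (?c ix * pq_number p q (int (?e ix))) *s (Y ^ (?e ix - 1) * f * Z)"
      by (simp only: poly_at_def sum_distrib_left sum_distrib_right scale_mult_right
          scale_mult_left scale_sum_right)
    finally show ?thesis
      by (simp add: mult_ac)
  qed
  have "X * g d \<mu> = (\<Sum>ix\<in>tuples d. ?c ix *s (X * Y ^ ?e ix))"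
    by (simp only: g_sum sum_distrib_left scale_mult_right)
  also have "\<dots> = (\<Sum>ix\<in>tuples d. (?c ix * q ^ ?e ix) *s (Y ^ ?e ix * X))
      + (\<Sum>ix\<in>tuples d. (?c ix * (h * pq_number p q (int (?e ix)))) *s (Y ^ (?e ix - 1) * f * Z))"
    by (simp only: X_Y_power scale_right_distrib scale_scale sum.distrib)
  also have "(\<Sum>ix\<in>tuples d. (?c ix * q ^ ?e ix) *s (Y ^ ?e ix * X)) =
      q powi (1 - int d) *s (g d (map Suc \<mu>) * X)"
    unfolding g_sum sum_distrib_right scale_sum_right scale_mult_left
    by (intro sum.cong refl grow)
  also have "(\<Sum>ix\<in>tuples d. (?c ix * (h * pq_number p q (int (?e ix)))) *s (Y ^ (?e ix - 1) * f * Z))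
      = h *s (g (Suc d) (\<mu> @ [0]) * Z)"
    unfolding g_sum sum_lists_snoc sum_distrib_right scale_sum_right[of h _ "tuples d"] scale_mult_left
    by (intro sum.cong refl append)
  finally show ?thesis .
qed

section \<open>The coefficients of the normal ordered form and their recursion in
  \<open>m\<close>\<close>

definition weight :: "nat \<Rightarrow> nat \<Rightarrow> nat list \<Rightarrow> 'k" where
  "weight m j \<mu> = q powi (int m - int j - int (sum_list \<mu>)) * p ^ sum_list \<mu>"

definition G :: "nat \<Rightarrow> nat \<Rightarrow> 'a" where
  "G m j = (\<Sum>\<mu>\<in>box_partitions (m - j) j. weight m j \<mu> *s g j \<mu>)"

text \<open>\<open>G_grow\<close> and \<open>G_append\<close> are the two contributions of step
  \<open>m\<close> to step \<open>m + 1\<close>, both indexed by the diagrams of step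
  \<open>m\<close> from which they arise.\<close>

definition G_grow :: "nat \<Rightarrow> nat \<Rightarrow> 'a" where
  "G_grow m j = (\<Sum>\<mu>\<in>box_partitions (m - j) j. weight (Suc m) j (map Suc \<mu>) *s g j (map Suc \<mu>))"

definition G_append :: "nat \<Rightarrow> nat \<Rightarrow> 'a" where
  "G_append m j = (\<Sum>\<mu>\<in>box_partitions (m - j) j. weight m j \<mu> *s g (Suc j) (\<mu> @ [0]))"

lemma X_G: "X * (G m j * Z ^ j) = G_grow m j * Z ^ j * X + h *s (G_append m j * Z ^ Suc j)"
proof -
  \<comment> \<open>Growing adds \<open>j\<close> boxes. \<open>X_Z_power\<close> pays p^j for them,
    and q^(1-j) from \<open>X_g\<close> turns m - j - |mu| into (m + 1) - j - (|mu| + j). These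
    exponents of \<open>q\<close> can be negative, hence \<open>powi\<close> and
    \<open>q_nonzero\<close>.\<close>
  have w: "weight m j \<mu> * (q powi (1 - int j) * p ^ j) = weight (Suc m) j (map Suc \<mu>)"
    if "\<mu> \<in> box_partitions (m - j) j" for \<mu>
  proof -
    have [simp]: "length \<mu> = j"
      using that by (simp add: box_partitions_def)
    have "q powi (int m - int j - int (sum_list \<mu>)) * q powi (1 - int j) =
        q powi (int (Suc m) - int j - int (sum_list (map Suc \<mu>)))"
      using q_nonzero by (simp add: sum_list_map_Suc algebra_simps flip: power_int_add)
    then show ?thesis
      by (simp add: weight_def sum_list_map_Suc power_add mult_ac)
  qed
  have "X * (G m j * Z ^ j) = (\<Sum>\<mu>\<in>box_partitions (m - j) j. weight m j \<mu> *s ((X * g j \<mu>) * Z ^ j))"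
    by (simp add: G_def sum_distrib_left sum_distrib_right scale_mult_left scale_mult_right mult.assoc)
  also have "\<dots> = (\<Sum>\<mu>\<in>box_partitions (m - j) j.
      weight (Suc m) j (map Suc \<mu>) *s (g j (map Suc \<mu>) * Z ^ j * X)
      + h *s (weight m j \<mu> *s (g (Suc j) (\<mu> @ [0]) * Z ^ Suc j)))"
  proof (rule sum.cong[OF refl])
    fix \<mu> assume \<mu>: "\<mu> \<in> box_partitions (m - j) j"
    then have "X * g j \<mu> = q powi (1 - int j) *s (g j (map Suc \<mu>) * X)
        + h *s (g (Suc j) (\<mu> @ [0]) * Z)"
      by (intro X_g) (simp add: box_partitions_def)
    then have "(X * g j \<mu>) * Z ^ j =
        (q powi (1 - int j) * p ^ j) *s (g j (map Suc \<mu>) * Z ^ j * X)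
        + h *s (g (Suc j) (\<mu> @ [0]) * Z ^ Suc j)"
      by (simp add: distrib_right scale_mult_left scale_mult_right mult.assoc X_Z_power)
    then show "weight m j \<mu> *s ((X * g j \<mu>) * Z ^ j) =
        weight (Suc m) j (map Suc \<mu>) *s (g j (map Suc \<mu>) * Z ^ j * X)
        + h *s (weight m j \<mu> *s (g (Suc j) (\<mu> @ [0]) * Z ^ Suc j))"
      by (simp only: scale_right_distrib scale_scale w[OF \<mu>] mult.commute[of h])
  qed
  finally show ?thesis
    by (simp only: G_grow_def G_append_def sum.distrib sum_distrib_right scale_mult_left
        scale_sum_right)
qed

lemma G_Suc_0: "G (Suc m) 0 = G_grow m 0"
  by (simp add: G_def G_grow_def box_partitions_0)

lemma weight_snoc_0: "weight (Suc m) (Suc j) (\<mu> @ [0]) = weight m j \<mu>"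
  by (simp add: weight_def)

text \<open>The split by the last column, read as a recursion. For \<open>j = m\<close> the box has
  no rows, so no diagram arises by growing. The \<open>if\<close> is essential: with truncated
  subtraction, \<open>G_grow m (Suc m)\<close> would still sum over the all-zero list.\<close>

lemma G_Suc_Suc:
  assumes "j \<le> m"
  shows "G (Suc m) (Suc j) = (if j < m then G_grow m (Suc j) else 0) + G_append m j"
proof -
  let ?F = "\<lambda>\<nu>. weight (Suc m) (Suc j) \<nu> *s g (Suc j) \<nu>"
  have "sum ?F {\<nu> \<in> box_partitions (m - j) (Suc j). last \<nu> \<noteq> 0} =
      (if j < m then G_grow m (Suc j) else 0)"
  proof (cases "j < m")
    case True
    then have "m - j = Suc (m - Suc j)"
      by simp
    with True show ?thesis
      by (simp only: G_grow_def sum_box_partitions_nonempty if_True)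
  next
    case False
    with assms have "m - j = 0"
      by simp
    with False show ?thesis
      by (simp only: box_partitions_last_nonempty_0 sum.empty if_False)
  qed
  then show ?thesis
    by (simp only: G_def G_append_def diff_Suc_Suc sum_box_partitions_split weight_snoc_0)
qed

lemma X_power_Y: "X ^ m * Y = (\<Sum>j=0..m. h ^ j *s (G m j * Z ^ j * X ^ (m - j)))"
proof (induction m)
  case 0
  have "g 0 [] = Y"
    by (simp add: g_poly_def)
  then show ?case
    by (simp add: G_def box_partitions_0 weight_def)
next
  case (Suc m)
  let ?A = "\<lambda>j. h ^ j *s (G_grow m j * Z ^ j * X ^ (Suc m - j))"
  let ?B = "\<lambda>j. h ^ Suc j *s (G_append m j * Z ^ Suc j * X ^ (m - j))"
  have "X ^ Suc m * Y = X * (X ^ m * Y)"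
    by (simp add: mult.assoc)
  also have "\<dots> = (\<Sum>j=0..m. h ^ j *s ((X * (G m j * Z ^ j)) * X ^ (m - j)))"
    by (simp add: Suc sum_distrib_left scale_mult_right mult.assoc)
  also have "\<dots> = (\<Sum>j=0..m. ?A j + ?B j)"
    unfolding X_G
    by (rule sum.cong)
      (auto simp: distrib_right scale_mult_left scale_right_distrib mult.assoc Suc_diff_le
        mult.commute[of _ h])
  \<comment> \<open>Growing keeps the power of \<open>Z\<close> while appending raises it by one.
    Shifting the \<open>?A\<close> terms and padding with 0 at \<open>j = m\<close> pairs terms with
    the same power, as \<open>G_Suc_Suc\<close> requires.\<close>
  also have "\<dots> = ?A 0 + (\<Sum>j=0..m. (if j < m then ?A (Suc j) else 0) + ?B j)"
  proof -
    have "(\<Sum>j=0..m. ?A j) = ?A 0 + (\<Sum>j<m. ?A (Suc j))"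
      using sum.lessThan_Suc_shift[of ?A m] by (simp only: atLeast0AtMost lessThan_Suc_atMost)
    moreover have "(\<Sum>j<m. ?A (Suc j)) = (\<Sum>j=0..m. if j < m then ?A (Suc j) else 0)"
      by (rule sum.mono_neutral_cong_left) auto
    ultimately show ?thesis
      by (simp only: sum.distrib add.assoc)
  qed
  also have "(\<Sum>j=0..m. (if j < m then ?A (Suc j) else 0) + ?B j) =
      (\<Sum>j=0..m. h ^ Suc j *s (G (Suc m) (Suc j) * Z ^ Suc j * X ^ (Suc m - Suc j)))"
    by (rule sum.cong) (auto simp: G_Suc_Suc distrib_right scale_right_distrib simp del: power_Suc)
  also have "?A 0 = h ^ 0 *s (G (Suc m) 0 * Z ^ 0 * X ^ (Suc m - 0))"
    by (simp add: G_Suc_0)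
  also have "\<dots> + (\<Sum>j=0..m. h ^ Suc j *s (G (Suc m) (Suc j) * Z ^ Suc j * X ^ (Suc m - Suc j)))
      = (\<Sum>j=0..Suc m. h ^ j *s (G (Suc m) j * Z ^ j * X ^ (Suc m - j)))"
    by (simp only: sum.atLeast0_atMost_Suc_shift o_def)
  finally show ?case .
qed

lemma G_normal_ordered: "G m j * Z ^ b * X ^ c \<in> normal_ordered scale Y Z X"
proof -
  have "g j \<mu> * Z ^ b * X ^ c \<in> normal_ordered scale Y Z X" for \<mu>
    unfolding g_poly_eq_sum_g_coeff[OF p_neq_q vector_space_axioms] sum_distrib_right scale_mult_left
      normal_ordered_def
    by (intro span_sum span_scale span_base) blast
  then show ?thesis
    unfolding G_def sum_distrib_right scale_mult_left normal_ordered_def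
    by (intro span_sum span_scale)
qed

end

theorem theorem2p7:
  fixes scale :: "'k::field \<Rightarrow> 'a::ring_1 \<Rightarrow> 'a" (infixr "*s" 75)
    and p q h :: 'k
    and s m :: nat
    and \<alpha> :: "nat \<Rightarrow> 'k"
    and X Y :: 'a
    and Z :: "'k \<Rightarrow> 'a"
  assumes "unital_algebra scale"
    and "q \<noteq> 0" and "p \<noteq> q"
    and "X * Y - q *s (Y * X) = h *s (poly_at scale s \<alpha> Y * Z p)"
    and "Z p * Y = p *s (Y * Z p)"
    and "X * Z p = p *s (Z p * X)"
    and "Z 1 = 1"
  shows "X ^ m * Y =
      (\<Sum>j=0..m. h ^ j *s
        ((\<Sum>\<mu>\<in>box_partitions (m - j) j.
            (q powi (int m - int j - int (sum_list \<mu>)) * p ^ sum_list \<mu>) *s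
              g_poly scale p q s \<alpha> j \<mu> Y)
          * Z p ^ j * X ^ (m - j)))
    \<and> X ^ m * Y \<in> normal_ordered scale Y (Z p) X"
proof -
  interpret unital_algebra scale by fact
  interpret pq_algebra scale p q h s \<alpha> X Y "Z p"
    by unfold_locales fact+
  have "X ^ m * Y = (\<Sum>j=0..m. h ^ j *s (G m j * Z p ^ j * X ^ (m - j)))"
    by (rule X_power_Y)
  moreover from this have "X ^ m * Y \<in> normal_ordered scale Y (Z p) X"
    using G_normal_ordered by (auto simp: normal_ordered_def intro!: span_sum span_scale)
  ultimately show ?thesis
    by (simp only: G_def weight_def)
qed

end
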